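(* Let $0\le\beta<1$. There exist constants $c,C>0$ (depending only on $\beta$) such that for every positive integer $n$, every function $f:\{-1,1\}^n\to\mathbb R$ that is 1-Lipschitz with respect to the Hamming distance, and every $u>0$, $$\pi_n\big(\{\sigma:\ |f(\sigma)-\pi_n(f)|\ge u\}\big)\le C e^{-u^2/(cn)},$$ where $\pi_n$ is the mean-field (Curie–Weiss) Ising measure at inverse temperature $\beta$ on $\{-1,1\}^n$.
   Context: The mean-field Ising (Curie–Weiss) measure is $\pi_n(\sigma)=\frac1{Z_n(\beta)}\exp\Big(\frac{\beta}{n}\sum_{1\le i<j\le n}\sigma(i)\sigma(j)\Big)$ for $\sigma\in\{-1,1\}^n$, with $Z_n(\beta)$ the normalising constant; $\pi_n(f)=\sum_\sigma\pi_n(\sigma)f(\sigma)$. The Hamming distance between two configurations is the number of coordinates in which they differ; $f$ is 1-Lipschitz if $|f(\sigma)-f(\sigma')|\le 1$ whenever $\sigma,\sigma'$ differ in exactly one coordinate. *)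

theory Defs
  imports Complex_Main "HOL-Library.FuncSet"
begin

text \<open>The dimension varies inside the theorem, so \<open>{-1,1}\<^sup>n\<close> is the set of extensional
  functions on \<open>{1..n}\<close>: coordinates outside \<open>{1..n}\<close> carry no information.\<close>

definition spin_configs :: "nat \<Rightarrow> (nat \<Rightarrow> real) set" where
  "spin_configs n = {1..n} \<rightarrow>\<^sub>E {-1, 1}"

definition hamming_dist :: "nat \<Rightarrow> (nat \<Rightarrow> real) \<Rightarrow> (nat \<Rightarrow> real) \<Rightarrow> nat" where
  "hamming_dist n \<sigma> \<sigma>' = card {i \<in> {1..n}. \<sigma> i \<noteq> \<sigma>' i}"

definition hamming_1_lipschitz :: "nat \<Rightarrow> ((nat \<Rightarrow> real) \<Rightarrow> real) \<Rightarrow> bool" where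
  "hamming_1_lipschitz n f \<longleftrightarrow>
     (\<forall>\<sigma>\<in>spin_configs n. \<forall>\<sigma>'\<in>spin_configs n.
        hamming_dist n \<sigma> \<sigma>' = 1 \<longrightarrow> \<bar>f \<sigma> - f \<sigma>'\<bar> \<le> 1)"

definition cw_weight :: "real \<Rightarrow> nat \<Rightarrow> (nat \<Rightarrow> real) \<Rightarrow> real" where
  "cw_weight \<beta> n \<sigma> =
     exp (\<beta> / real n * (\<Sum>(i, j) \<in> {(i, j). 1 \<le> i \<and> i < j \<and> j \<le> n}. \<sigma> i * \<sigma> j))"

definition cw_partition :: "real \<Rightarrow> nat \<Rightarrow> real" where
  "cw_partition \<beta> n = (\<Sum>\<sigma>\<in>spin_configs n. cw_weight \<beta> n \<sigma>)"

definition cw_mass :: "real \<Rightarrow> nat \<Rightarrow> (nat \<Rightarrow> real) \<Rightarrow> real" where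
  "cw_mass \<beta> n \<sigma> = cw_weight \<beta> n \<sigma> / cw_partition \<beta> n"

definition cw_expectation :: "real \<Rightarrow> nat \<Rightarrow> ((nat \<Rightarrow> real) \<Rightarrow> real) \<Rightarrow> real" where
  "cw_expectation \<beta> n f = (\<Sum>\<sigma>\<in>spin_configs n. cw_mass \<beta> n \<sigma> * f \<sigma>)"

definition cw_prob :: "real \<Rightarrow> nat \<Rightarrow> (nat \<Rightarrow> real) set \<Rightarrow> real" where
  "cw_prob \<beta> n A = (\<Sum>\<sigma>\<in>spin_configs n \<inter> A. cw_mass \<beta> n \<sigma>)"

end

theory Submission
  imports Defs
begin

text \<open>
  Let \<open>P\<close> be the random-scan heat-bath (Glauber) kernel. It leaves \<open>\<pi>\<^sub>n\<close> invariant, each step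
  changes at most one coordinate, and, since resampling a coordinate depends on another one only
  through \<open>tanh\<close> of the mean field, \<open>P\<close> multiplies Lipschitz constants by at most
  \<open>\<rho> = 1 - (1 - \<beta>) / n\<close>. For an \<open>L\<close>-Lipschitz \<open>g\<close> one step gives
  \<open>P(exp g) \<le> exp (P g + 4 L\<^sup>2)\<close>; integrating against \<open>\<pi>\<^sub>n\<close> and iterating along the geometrically
  contracting sequence \<open>g, P g, P\<^sup>2 g, \<dots>\<close> bounds \<open>\<pi>\<^sub>n(exp g)\<close> by
  \<open>exp (\<pi>\<^sub>n(g) + 4 L\<^sup>2 n / (1 - \<beta>))\<close>, and Chernoff's bound finishes.
\<close>

section \<open>Two elementary inequalities for \<open>exp\<close> and \<open>tanh\<close>\<close>

text \<open>On [-1, 1], exp x is at most 1 + x + x^2, and 1 + x^2 is at most exp (x^2). Above 1, x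
  \<le> x^2 suffices; below -1, exp x \<le> 1 and x + x^2 is nonnegative. For a centred variable the
  linear term averages out, which leaves a Gaussian bound.\<close>

lemma exp_le_add_exp_square:
  fixes x :: real
  shows "exp x \<le> x + exp (x\<^sup>2)"
proof -
  have sq: "1 + x\<^sup>2 \<le> exp (x\<^sup>2)" by (rule exp_ge_add_one_self)
  consider "x \<le> -1" | "-1 \<le> x" "x \<le> 0" | "0 \<le> x" "x \<le> 1" | "1 \<le> x" by linarith
  then show ?thesis
  proof cases
    case 1
    have "0 \<le> (x + 1) * x" using 1 by (intro mult_nonpos_nonpos) auto
    then have "0 \<le> x + x\<^sup>2" by (simp add: power2_eq_square algebra_simps)
    moreover have "exp x \<le> 1" using 1 by simp
    ultimately show ?thesis using sq by linarith
  next
    case 2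
    define y where "y = - x"
    have y: "0 \<le> y" using 2 by (simp add: y_def)
    \<comment> \<open>The Taylor bound for \<open>exp y\<close> is a lower bound; a product that is
      at least 1 converts it into an upper bound for \<open>exp (- y)\<close>.\<close>
    have "1 \<le> 1 + y\<^sup>2 / 2 + y ^ 3 / 2 + y ^ 4 / 2" using y by simp
    also have "\<dots> = (1 - y + y\<^sup>2) * (1 + y + y\<^sup>2 / 2)"
      by (simp add: power2_eq_square power3_eq_cube power4_eq_xxxx field_simps)
    also have "\<dots> \<le> (1 - y + y\<^sup>2) * exp y"
    proof (rule mult_left_mono)
      show "1 + y + y\<^sup>2 / 2 \<le> exp y" by (rule exp_lower_Taylor_quadratic[OF y])
      have "0 \<le> (y - 1/2)\<^sup>2" by simp
      then show "0 \<le> 1 - y + y\<^sup>2" by (simp add: power2_eq_square algebra_simps)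
    qed
    finally have "exp (- y) \<le> 1 - y + y\<^sup>2" by (simp add: exp_minus field_simps)
    then have "exp x \<le> 1 + x + x\<^sup>2" by (simp add: y_def)
    then show ?thesis using sq by linarith
  next
    case 3
    then show ?thesis using exp_bound[of x] sq by linarith
  next
    case 4
    have "x * 1 \<le> x * x" using 4 by (intro mult_left_mono) auto
    then have "exp x \<le> exp (x\<^sup>2)" by (simp add: power2_eq_square)
    then show ?thesis using 4 by linarith
  qed
qed

text \<open>The function t - tanh t has derivative (tanh t)^2, so it is nondecreasing; monotonicity
  of \<open>tanh\<close> handles the other sign.\<close>

lemma tanh_real_lipschitz:
  fixes x y :: real
  shows "\<bar>tanh x - tanh y\<bar> \<le> \<bar>x - y\<bar>"
proof -
  have *: "tanh b - tanh a \<le> b - a" if "a \<le> b" for a b :: real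
  proof -
    have "b - tanh b \<ge> a - tanh a"
    proof (rule DERIV_nonneg_imp_nondecreasing[OF that])
      fix t :: real
      have "((\<lambda>t. t - tanh t) has_real_derivative 1 - (1 - tanh t ^ 2)) (at t)"
        by (auto intro!: derivative_eq_intros)
      then show "\<exists>D. ((\<lambda>t. t - tanh t) has_real_derivative D) (at t) \<and> 0 \<le> D" by auto
    qed
    then show ?thesis by simp
  qed
  have "a \<le> b \<Longrightarrow> tanh a \<le> tanh b" for a b :: real by simp
  from this[of x y] this[of y x] *[of x y] *[of y x] show ?thesis by linarith
qed

section \<open>Spin flips and expectations under the Curie-Weiss measure\<close>

definition flip :: "nat \<Rightarrow> (nat \<Rightarrow> real) \<Rightarrow> nat \<Rightarrow> real" where
  "flip i \<sigma> = \<sigma>(i := - \<sigma> i)"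

lemma finite_spin_configs: "finite (spin_configs n)"
  by (simp add: spin_configs_def finite_PiE)

lemma spin_value: "\<sigma> \<in> spin_configs n \<Longrightarrow> i \<in> {1..n} \<Longrightarrow> \<sigma> i = 1 \<or> \<sigma> i = -1"
  by (auto simp: spin_configs_def PiE_def Pi_def)

lemma spin_configs_upd:
  "\<sigma> \<in> spin_configs n \<Longrightarrow> i \<in> {1..n} \<Longrightarrow> s = 1 \<or> s = -1 \<Longrightarrow> \<sigma>(i := s) \<in> spin_configs n"
  by (auto simp: spin_configs_def PiE_def Pi_def extensional_def)

lemma flip_spin_configs:
  "\<sigma> \<in> spin_configs n \<Longrightarrow> i \<in> {1..n} \<Longrightarrow> flip i \<sigma> \<in> spin_configs n"
  unfolding flip_def using spin_value[of \<sigma> n i] by (auto intro!: spin_configs_upd)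

lemma flip_flip [simp]: "flip i (flip i \<sigma>) = \<sigma>"
  by (simp add: flip_def)

lemma spin_configs_nonempty: "spin_configs n \<noteq> {}"
  by (simp add: spin_configs_def PiE_eq_empty_iff)

lemma sum_flip:
  assumes "i \<in> {1..n}"
  shows "(\<Sum>\<sigma>\<in>spin_configs n. h (flip i \<sigma>)) = (\<Sum>\<sigma>\<in>spin_configs n. h \<sigma>)"
  by (rule sum.reindex_bij_witness[where i = "flip i" and j = "flip i"])
     (use assms in \<open>auto intro: flip_spin_configs\<close>)

lemma cw_weight_pos: "0 < cw_weight \<beta> n \<sigma>"
  by (simp add: cw_weight_def)

lemma cw_partition_pos: "0 < cw_partition \<beta> n"
  unfolding cw_partition_def
  by (intro sum_pos finite_spin_configs spin_configs_nonempty cw_weight_pos)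

lemma cw_mass_nonneg: "0 \<le> cw_mass \<beta> n \<sigma>"
  using cw_weight_pos[of \<beta> n \<sigma>] cw_partition_pos[of \<beta> n] by (simp add: cw_mass_def)

lemma sum_cw_mass: "(\<Sum>\<sigma>\<in>spin_configs n. cw_mass \<beta> n \<sigma>) = 1"
  using cw_partition_pos[of \<beta> n]
  by (simp add: cw_mass_def cw_partition_def flip: sum_divide_distrib)

lemma cw_expectation_mono:
  assumes "\<And>\<sigma>. \<sigma> \<in> spin_configs n \<Longrightarrow> f \<sigma> \<le> g \<sigma>"
  shows "cw_expectation \<beta> n f \<le> cw_expectation \<beta> n g"
  unfolding cw_expectation_def by (intro sum_mono mult_left_mono assms cw_mass_nonneg)

lemma cw_expectation_const: "cw_expectation \<beta> n (\<lambda>_. c) = c"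
  by (simp add: cw_expectation_def sum_cw_mass flip: sum_distrib_right)

lemma cw_expectation_cmult: "cw_expectation \<beta> n (\<lambda>\<sigma>. c * f \<sigma>) = c * cw_expectation \<beta> n f"
  by (simp add: cw_expectation_def sum_distrib_left algebra_simps)

text \<open>Expands the square of the total spin. For spins the squares add up to n, so the pair
  energy is a function of the magnetisation alone. The induction splits off the pairs whose larger
  index is \<open>Suc n\<close>.\<close>

lemma sum_pairs_eq_square:
  fixes s :: "nat \<Rightarrow> real"
  shows "2 * (\<Sum>(i, j) \<in> {(i, j). 1 \<le> i \<and> i < j \<and> j \<le> n}. s i * s j)
    = (\<Sum>i\<in>{1..n}. s i)\<^sup>2 - (\<Sum>i\<in>{1..n}. (s i)\<^sup>2)"
proof (induction n)
  case 0
  have empty: "{(i, j). 1 \<le> i \<and> i < j \<and> j \<le> (0::nat)} = {}" by auto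
  show ?case unfolding empty by simp
next
  case (Suc n)
  let ?A = "{(i, j). 1 \<le> i \<and> i < j \<and> j \<le> n}"
  have fin: "finite ?A" by (rule finite_subset[of _ "{1..n} \<times> {1..n}"]) auto
  have split: "{(i, j). 1 \<le> i \<and> i < j \<and> j \<le> Suc n} = ?A \<union> (\<lambda>i. (i, Suc n)) ` {1..n}"
    by auto
  have "(\<Sum>(i, j) \<in> {(i, j). 1 \<le> i \<and> i < j \<and> j \<le> Suc n}. s i * s j)
      = (\<Sum>(i, j) \<in> ?A. s i * s j) + (\<Sum>(i, j) \<in> (\<lambda>i. (i, Suc n)) ` {1..n}. s i * s j)"
    unfolding split using fin by (intro sum.union_disjoint) auto
  also have "(\<Sum>(i, j) \<in> (\<lambda>i. (i, Suc n)) ` {1..n}. s i * s j) = (\<Sum>i\<in>{1..n}. s i) * s (Suc n)"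
    by (subst sum.reindex) (auto simp: inj_on_def sum_distrib_right)
  finally show ?case using Suc.IH by (simp add: power2_eq_square algebra_simps)
qed

section \<open>The heat-bath kernel and its invariant measure\<close>

text \<open>Site i is left out, so the field acting on a spin does not depend on that spin.\<close>

definition mean_field :: "real \<Rightarrow> nat \<Rightarrow> nat \<Rightarrow> (nat \<Rightarrow> real) \<Rightarrow> real" where
  "mean_field \<beta> n i \<sigma> = \<beta> / real n * (\<Sum>j\<in>{1..n} - {i}. \<sigma> j)"

text \<open>With m the mean field, this equals e^m / (e^m + e^(-m)): the conditional probability
  under the measure that spin i is +1 given all the others.\<close>

definition plus_prob :: "real \<Rightarrow> nat \<Rightarrow> nat \<Rightarrow> (nat \<Rightarrow> real) \<Rightarrow> real" where
  "plus_prob \<beta> n i \<sigma> = (1 + tanh (mean_field \<beta> n i \<sigma>)) / 2"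

definition heat_bath ::
    "real \<Rightarrow> nat \<Rightarrow> nat \<Rightarrow> ((nat \<Rightarrow> real) \<Rightarrow> real) \<Rightarrow> (nat \<Rightarrow> real) \<Rightarrow> real" where
  "heat_bath \<beta> n i g \<sigma> =
     plus_prob \<beta> n i \<sigma> * g (\<sigma>(i := 1)) + (1 - plus_prob \<beta> n i \<sigma>) * g (\<sigma>(i := -1))"

definition glauber ::
    "real \<Rightarrow> nat \<Rightarrow> ((nat \<Rightarrow> real) \<Rightarrow> real) \<Rightarrow> (nat \<Rightarrow> real) \<Rightarrow> real" where
  "glauber \<beta> n g \<sigma> = (\<Sum>i\<in>{1..n}. heat_bath \<beta> n i g \<sigma>) / real n"

lemma mean_field_upd [simp]: "mean_field \<beta> n i (\<sigma>(i := s)) = mean_field \<beta> n i \<sigma>"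
  unfolding mean_field_def by (intro arg_cong2[where f = "(*)"] refl sum.cong) auto

lemma heat_bath_upd [simp]: "heat_bath \<beta> n i g (\<sigma>(i := s)) = heat_bath \<beta> n i g \<sigma>"
  by (simp add: heat_bath_def plus_prob_def)

lemma plus_prob_nonneg: "0 \<le> plus_prob \<beta> n i \<sigma>" and plus_prob_le_1: "plus_prob \<beta> n i \<sigma> \<le> 1"
  unfolding plus_prob_def
  using tanh_real_lt_1[of "mean_field \<beta> n i \<sigma>"] tanh_real_gt_neg1[of "mean_field \<beta> n i \<sigma>"]
  by auto

text \<open>With T the sum of the other spins, s^2 = 1 makes the pair energy ((s + T)^2 - n) / 2
  equal to (T^2 + 1 - n) / 2 + s T. Only the last factor sees s, so the prefactor cancels in
  conditional probabilities.\<close>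

lemma cw_weight_upd:
  assumes \<sigma>: "\<sigma> \<in> spin_configs n" and i: "i \<in> {1..n}" and s: "s = 1 \<or> s = -1"
  shows "cw_weight \<beta> n (\<sigma>(i := s))
    = exp (\<beta> / real n * (((\<Sum>j\<in>{1..n} - {i}. \<sigma> j)\<^sup>2 + 1 - real n) / 2)) * exp (s * mean_field \<beta> n i \<sigma>)"
proof -
  let ?\<tau> = "\<sigma>(i := s)" and ?T = "\<Sum>j\<in>{1..n} - {i}. \<sigma> j"
  have \<tau>: "?\<tau> \<in> spin_configs n" by (rule spin_configs_upd[OF \<sigma> i s])
  have "(?\<tau> j)\<^sup>2 = 1" if "j \<in> {1..n}" for j
    using spin_value[OF \<tau> that] by (metis power2_minus one_power2)
  then have sq: "(\<Sum>j\<in>{1..n}. (?\<tau> j)\<^sup>2) = real n" by simp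
  have "(\<Sum>j\<in>{1..n}. ?\<tau> j) = ?\<tau> i + (\<Sum>j\<in>{1..n} - {i}. ?\<tau> j)"
    using i by (intro sum.remove) auto
  also have "(\<Sum>j\<in>{1..n} - {i}. ?\<tau> j) = ?T" by (intro sum.cong) auto
  finally have tot: "(\<Sum>j\<in>{1..n}. ?\<tau> j) = s + ?T" by simp
  have ss: "s * s = 1" using s by auto
  define E where "E = (\<Sum>(i, j) \<in> {(i, j). 1 \<le> i \<and> i < j \<and> j \<le> n}. ?\<tau> i * ?\<tau> j)"
  have "2 * E = (s + ?T)\<^sup>2 - real n"
    using sum_pairs_eq_square[of ?\<tau> n] unfolding sq tot E_def .
  then have "E = ((s + ?T)\<^sup>2 - real n) / 2" by simp
  also have "\<dots> = (?T\<^sup>2 + 1 - real n) / 2 + s * ?T"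
    using ss by (simp add: power2_eq_square field_simps)
  finally show ?thesis
    unfolding cw_weight_def E_def[symmetric] mean_field_def exp_add[symmetric]
    by (simp add: algebra_simps)
qed

text \<open>Identifies \<open>heat_bath\<close> as the conditional expectation of \<open>g\<close>
  given the spins off site i, in a form cleared of denominators.\<close>

lemma heat_bath_weighted:
  assumes \<sigma>: "\<sigma> \<in> spin_configs n" and i: "i \<in> {1..n}"
  shows "(cw_weight \<beta> n (\<sigma>(i := 1)) + cw_weight \<beta> n (\<sigma>(i := -1))) * heat_bath \<beta> n i g \<sigma>
    = cw_weight \<beta> n (\<sigma>(i := 1)) * g (\<sigma>(i := 1)) + cw_weight \<beta> n (\<sigma>(i := -1)) * g (\<sigma>(i := -1))"
proof -
  define m where "m = mean_field \<beta> n i \<sigma>"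
  define E where "E = exp (\<beta> / real n * (((\<Sum>j\<in>{1..n} - {i}. \<sigma> j)\<^sup>2 + 1 - real n) / 2))"
  have wp: "cw_weight \<beta> n (\<sigma>(i := 1)) = E * exp m"
    using cw_weight_upd[OF \<sigma> i, of 1 \<beta>] by (simp add: E_def m_def)
  have wm: "cw_weight \<beta> n (\<sigma>(i := -1)) = E * exp (- m)"
    using cw_weight_upd[OF \<sigma> i, of "-1" \<beta>] by (simp add: E_def m_def)
  have pos: "exp m + exp (- m) > 0" by (simp add: add_pos_pos)
  have p: "plus_prob \<beta> n i \<sigma> = exp m / (exp m + exp (- m))"
    using pos unfolding plus_prob_def m_def[symmetric] tanh_def sinh_def cosh_def
    by (simp add: field_simps)
  have 1: "(exp m + exp (- m)) * plus_prob \<beta> n i \<sigma> = exp m"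
    and 2: "(exp m + exp (- m)) * (1 - plus_prob \<beta> n i \<sigma>) = exp (- m)"
    unfolding p using pos by (simp_all add: field_simps)
  have "(E * exp m + E * exp (- m)) * heat_bath \<beta> n i g \<sigma>
    = E * ((exp m + exp (- m)) * plus_prob \<beta> n i \<sigma>) * g (\<sigma>(i := 1))
      + E * ((exp m + exp (- m)) * (1 - plus_prob \<beta> n i \<sigma>)) * g (\<sigma>(i := -1))"
    unfolding heat_bath_def by (simp add: algebra_simps)
  then show ?thesis unfolding 1 2 wp wm .
qed

text \<open>The same identity regardless of which of \<sigma> and its flip carries the spin +1,
  ready for summation over all configurations.\<close>

lemma heat_bath_flip_pair:
  assumes \<sigma>: "\<sigma> \<in> spin_configs n" and i: "i \<in> {1..n}"
  shows "(cw_weight \<beta> n \<sigma> + cw_weight \<beta> n (flip i \<sigma>)) * heat_bath \<beta> n i g \<sigma>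
    = cw_weight \<beta> n \<sigma> * g \<sigma> + cw_weight \<beta> n (flip i \<sigma>) * g (flip i \<sigma>)"
proof -
  from spin_value[OF \<sigma> i] consider "\<sigma> i = 1" | "\<sigma> i = -1" by blast
  then show ?thesis
  proof cases
    case 1
    then have "\<sigma>(i := 1) = \<sigma>" "\<sigma>(i := -1) = flip i \<sigma>" by (auto simp: flip_def)
    then show ?thesis using heat_bath_weighted[OF \<sigma> i, of \<beta> g] by simp
  next
    case 2
    then have "\<sigma>(i := -1) = \<sigma>" "\<sigma>(i := 1) = flip i \<sigma>" by (auto simp: flip_def)
    then show ?thesis using heat_bath_weighted[OF \<sigma> i, of \<beta> g] by (simp add: add.commute)
  qed
qed

lemma sum_weight_heat_bath:
  assumes i: "i \<in> {1..n}"
  shows "(\<Sum>\<sigma>\<in>spin_configs n. cw_weight \<beta> n \<sigma> * heat_bath \<beta> n i g \<sigma>)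
    = (\<Sum>\<sigma>\<in>spin_configs n. cw_weight \<beta> n \<sigma> * g \<sigma>)" (is "?L = ?R")
proof -
  have inv: "heat_bath \<beta> n i g (flip i \<sigma>) = heat_bath \<beta> n i g \<sigma>" for \<sigma>
    by (simp add: flip_def)
  \<comment> \<open>Adding the copy of the sum reindexed by the flip groups the weights in pairs, on
    each of which \<open>heat_bath\<close> is constant.\<close>
  have "2 * ?L = ?L + (\<Sum>\<sigma>\<in>spin_configs n. cw_weight \<beta> n (flip i \<sigma>) * heat_bath \<beta> n i g (flip i \<sigma>))"
    by (simp add: sum_flip[OF i, of "\<lambda>\<sigma>. cw_weight \<beta> n \<sigma> * heat_bath \<beta> n i g \<sigma>"])
  also have "\<dots> = (\<Sum>\<sigma>\<in>spin_configs n.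
      (cw_weight \<beta> n \<sigma> + cw_weight \<beta> n (flip i \<sigma>)) * heat_bath \<beta> n i g \<sigma>)"
    by (simp add: inv sum.distrib algebra_simps)
  also have "\<dots> = (\<Sum>\<sigma>\<in>spin_configs n.
      cw_weight \<beta> n \<sigma> * g \<sigma> + cw_weight \<beta> n (flip i \<sigma>) * g (flip i \<sigma>))"
    by (intro sum.cong refl heat_bath_flip_pair i)
  also have "\<dots> = 2 * ?R"
    by (simp add: sum.distrib sum_flip[OF i, of "\<lambda>\<sigma>. cw_weight \<beta> n \<sigma> * g \<sigma>"])
  finally show ?thesis by simp
qed

lemma cw_expectation_glauber:
  assumes "n > 0"
  shows "cw_expectation \<beta> n (glauber \<beta> n g) = cw_expectation \<beta> n g"
proof -
  have expect: "cw_expectation \<beta> n h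
      = (\<Sum>\<sigma>\<in>spin_configs n. cw_weight \<beta> n \<sigma> * h \<sigma>) / cw_partition \<beta> n" for h
    by (simp add: cw_expectation_def cw_mass_def sum_divide_distrib)
  have "(\<Sum>\<sigma>\<in>spin_configs n. cw_weight \<beta> n \<sigma> * glauber \<beta> n g \<sigma>)
      = (\<Sum>\<sigma>\<in>spin_configs n. \<Sum>i\<in>{1..n}. cw_weight \<beta> n \<sigma> * heat_bath \<beta> n i g \<sigma>) / real n"
    by (simp add: glauber_def sum_distrib_left sum_divide_distrib)
  also have "\<dots> = (\<Sum>i\<in>{1..n}. \<Sum>\<sigma>\<in>spin_configs n. cw_weight \<beta> n \<sigma> * heat_bath \<beta> n i g \<sigma>) / real n"
    by (subst sum.swap) simp
  also have "\<dots> = (\<Sum>i\<in>{1..n}. \<Sum>\<sigma>\<in>spin_configs n. cw_weight \<beta> n \<sigma> * g \<sigma>) / real n"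
    by (simp only: sum_weight_heat_bath cong: sum.cong)
  also have "\<dots> = (\<Sum>\<sigma>\<in>spin_configs n. cw_weight \<beta> n \<sigma> * g \<sigma>)"
    using assms by simp
  finally show ?thesis by (simp add: expect)
qed

section \<open>Lipschitz functions on the configuration space\<close>

text \<open>Spin configurations at Hamming distance one are exactly those related by a flip. A
  general constant L is kept because the kernel contracts it and the Chernoff parameter rescales
  it.\<close>

definition flip_lipschitz :: "nat \<Rightarrow> real \<Rightarrow> ((nat \<Rightarrow> real) \<Rightarrow> real) \<Rightarrow> bool" where
  "flip_lipschitz n L g \<longleftrightarrow>
     (\<forall>\<sigma>\<in>spin_configs n. \<forall>i\<in>{1..n}. \<bar>g (flip i \<sigma>) - g \<sigma>\<bar> \<le> L)"

lemma hamming_1_lipschitz_flip: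
  assumes "hamming_1_lipschitz n f"
  shows "flip_lipschitz n 1 f"
  unfolding flip_lipschitz_def
proof (intro ballI)
  fix \<sigma> i assume \<sigma>: "\<sigma> \<in> spin_configs n" and i: "i \<in> {1..n}"
  have "\<sigma> i \<noteq> 0" using spin_value[OF \<sigma> i] by auto
  then have "{j \<in> {1..n}. flip i \<sigma> j \<noteq> \<sigma> j} = {i}" using i by (auto simp: flip_def)
  then have "hamming_dist n (flip i \<sigma>) \<sigma> = 1" by (simp add: hamming_dist_def)
  then show "\<bar>f (flip i \<sigma>) - f \<sigma>\<bar> \<le> 1"
    using assms \<sigma> flip_spin_configs[OF \<sigma> i] by (auto simp: hamming_1_lipschitz_def)
qed

lemma flip_lipschitz_cmult:
  assumes "flip_lipschitz n L g"
  shows "flip_lipschitz n (\<bar>a\<bar> * L) (\<lambda>\<sigma>. a * g \<sigma>)"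
  using assms unfolding flip_lipschitz_def
  by (auto simp: abs_mult intro!: mult_left_mono simp flip: right_diff_distrib)

lemma flip_lipschitz_nonneg:
  assumes "flip_lipschitz n L g" "n > 0"
  shows "0 \<le> L"
proof -
  obtain \<sigma> where "\<sigma> \<in> spin_configs n" using spin_configs_nonempty by blast
  then have "\<bar>g (flip 1 \<sigma>) - g \<sigma>\<bar> \<le> L" using assms by (auto simp: flip_lipschitz_def)
  then show ?thesis by linarith
qed

lemma flip_lipschitz_upd:
  assumes g: "flip_lipschitz n L g" "0 \<le> L" and \<sigma>: "\<sigma> \<in> spin_configs n" and i: "i \<in> {1..n}"
    and s: "s = 1 \<or> s = -1"
  shows "\<bar>g (\<sigma>(i := s)) - g \<sigma>\<bar> \<le> L"
proof (cases "s = \<sigma> i")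
  case True
  then show ?thesis using g by simp
next
  case False
  then have "\<sigma>(i := s) = flip i \<sigma>" using s spin_value[OF \<sigma> i] by (auto simp: flip_def)
  then show ?thesis using g \<sigma> i by (auto simp: flip_lipschitz_def)
qed

text \<open>Walk from \<sigma> to \<tau> by flipping one disagreeing site at a time; with two spin
  values each flip repairs its site.\<close>

lemma flip_lipschitz_hamming:
  assumes g: "flip_lipschitz n L g"
  shows "\<sigma> \<in> spin_configs n \<Longrightarrow> \<tau> \<in> spin_configs n \<Longrightarrow>
    \<bar>g \<sigma> - g \<tau>\<bar> \<le> real (hamming_dist n \<sigma> \<tau>) * L"
proof (induction "hamming_dist n \<sigma> \<tau>" arbitrary: \<sigma>)
  case 0
  then have "\<And>i. i \<in> {1..n} \<Longrightarrow> \<sigma> i = \<tau> i" by (auto simp: hamming_dist_def)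
  then have "\<sigma> = \<tau>"
    using 0 unfolding spin_configs_def by (intro PiE_ext)
  then show ?case by (simp add: hamming_dist_def)
next
  case (Suc m)
  let ?D = "{i \<in> {1..n}. \<sigma> i \<noteq> \<tau> i}"
  have "?D \<noteq> {}" using Suc.hyps(2) unfolding hamming_dist_def by (metis card.empty nat.distinct(1))
  then obtain k where k: "k \<in> {1..n}" "\<sigma> k \<noteq> \<tau> k" by auto
  have "flip k \<sigma> k = \<tau> k"
    using spin_value[OF Suc.prems(1) k(1)] spin_value[OF Suc.prems(2) k(1)] k(2)
    by (auto simp: flip_def)
  then have "{i \<in> {1..n}. flip k \<sigma> i \<noteq> \<tau> i} = ?D - {k}" by (auto simp: flip_def)
  then have m: "m = hamming_dist n (flip k \<sigma>) \<tau>"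
    using Suc.hyps(2) k by (simp add: hamming_dist_def)
  have "\<bar>g (flip k \<sigma>) - g \<tau>\<bar> \<le> real m * L"
    using Suc.hyps(1)[OF m flip_spin_configs[OF Suc.prems(1) k(1)] Suc.prems(2)] m by simp
  moreover have "\<bar>g (flip k \<sigma>) - g \<sigma>\<bar> \<le> L" using g Suc.prems(1) k by (auto simp: flip_lipschitz_def)
  ultimately show ?case by (simp add: Suc.hyps(2)[symmetric] algebra_simps)
qed

text \<open>The Hamming diameter is at most n. This crude bound starts the iteration of the
  exponential moment estimate.\<close>

lemma flip_lipschitz_le_expectation:
  assumes g: "flip_lipschitz n L g" "n > 0" and \<sigma>: "\<sigma> \<in> spin_configs n"
  shows "g \<sigma> \<le> cw_expectation \<beta> n g + real n * L"
proof -
  have "g \<sigma> - real n * L \<le> g \<tau>" if \<tau>: "\<tau> \<in> spin_configs n" for \<tau>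
  proof -
    have "hamming_dist n \<sigma> \<tau> \<le> card {1..n}" unfolding hamming_dist_def by (intro card_mono) auto
    then have "real (hamming_dist n \<sigma> \<tau>) * L \<le> real n * L"
      using flip_lipschitz_nonneg[OF g] by (intro mult_right_mono) auto
    then show ?thesis using flip_lipschitz_hamming[OF g(1) \<sigma> \<tau>] by linarith
  qed
  then have "cw_expectation \<beta> n (\<lambda>_. g \<sigma> - real n * L) \<le> cw_expectation \<beta> n g"
    by (rule cw_expectation_mono)
  then show ?thesis by (simp add: cw_expectation_const)
qed

section \<open>Contraction of Lipschitz constants under the kernel\<close>

text \<open>Flipping a spin moves the sum in the field by at most 2 (by 0 if k = i);
  \<open>tanh\<close> does not expand this, and the 1/2 in \<open>plus_prob\<close> cancels the
  2.\<close>

lemma plus_prob_flip: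
  assumes "0 \<le> \<beta>" and \<sigma>: "\<sigma> \<in> spin_configs n" and k: "k \<in> {1..n}"
  shows "\<bar>plus_prob \<beta> n i (flip k \<sigma>) - plus_prob \<beta> n i \<sigma>\<bar> \<le> \<beta> / real n"
proof -
  have "\<bar>(\<Sum>j\<in>{1..n} - {i}. flip k \<sigma> j) - (\<Sum>j\<in>{1..n} - {i}. \<sigma> j)\<bar>
      = \<bar>\<Sum>j\<in>{1..n} - {i}. if j = k then - 2 * \<sigma> k else 0\<bar>"
    unfolding sum_subtractf[symmetric]
    by (intro arg_cong[where f = abs] sum.cong) (auto simp: flip_def)
  also have "\<dots> \<le> 2" using spin_value[OF \<sigma> k] by (auto simp: sum.delta)
  finally have "\<beta> / real n * \<bar>(\<Sum>j\<in>{1..n} - {i}. flip k \<sigma> j) - (\<Sum>j\<in>{1..n} - {i}. \<sigma> j)\<bar>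
      \<le> \<beta> / real n * 2"
    using assms(1) by (intro mult_left_mono) auto
  then have "\<bar>mean_field \<beta> n i (flip k \<sigma>) - mean_field \<beta> n i \<sigma>\<bar> \<le> \<beta> / real n * 2"
    using assms(1) unfolding mean_field_def right_diff_distrib[symmetric] abs_mult by simp
  with tanh_real_lipschitz[of "mean_field \<beta> n i (flip k \<sigma>)" "mean_field \<beta> n i \<sigma>"]
  have "\<bar>tanh (mean_field \<beta> n i (flip k \<sigma>)) - tanh (mean_field \<beta> n i \<sigma>)\<bar> \<le> \<beta> / real n * 2"
    by linarith
  then show ?thesis
    unfolding plus_prob_def diff_divide_distrib[symmetric] by (simp add: abs_if field_simps split: if_splits)
qed

text \<open>First change the values under the fixed weight a, which costs L; then change the weight
  between the fixed values x' and y', which costs d L.\<close>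

lemma abs_mixture_diff_le:
  fixes a b x y x' y' L :: real
  assumes "0 \<le> a" "a \<le> 1" "\<bar>x - x'\<bar> \<le> L" "\<bar>y - y'\<bar> \<le> L" "\<bar>x' - y'\<bar> \<le> L" "\<bar>a - b\<bar> \<le> d" "0 \<le> L"
  shows "\<bar>(a * x + (1 - a) * y) - (b * x' + (1 - b) * y')\<bar> \<le> L + d * L"
proof -
  have "(a * x + (1 - a) * y) - (b * x' + (1 - b) * y')
      = a * (x - x') + (1 - a) * (y - y') + (a - b) * (x' - y')"
    by (simp add: algebra_simps)
  also have "\<bar>\<dots>\<bar> \<le> a * \<bar>x - x'\<bar> + (1 - a) * \<bar>y - y'\<bar> + \<bar>a - b\<bar> * \<bar>x' - y'\<bar>"
    using assms(1,2) by (intro order.trans[OF abs_triangle_ineq] add_mono) (auto simp: abs_mult)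
  also have "\<dots> \<le> a * L + (1 - a) * L + d * L"
    using assms by (intro add_mono mult_left_mono mult_mono) auto
  finally show ?thesis by (simp add: algebra_simps)
qed

lemma heat_bath_flip_diff:
  assumes \<beta>: "0 \<le> \<beta>" and g: "flip_lipschitz n L g" "0 \<le> L" and \<sigma>: "\<sigma> \<in> spin_configs n"
    and i: "i \<in> {1..n}" and k: "k \<in> {1..n}" and "i \<noteq> k"
  shows "\<bar>heat_bath \<beta> n i g (flip k \<sigma>) - heat_bath \<beta> n i g \<sigma>\<bar> \<le> L + \<beta> / real n * L"
proof -
  have comm: "(flip k \<sigma>)(i := s) = flip k (\<sigma>(i := s))" for s
    using \<open>i \<noteq> k\<close> by (auto simp: flip_def)
  have nbr: "\<bar>g ((flip k \<sigma>)(i := s)) - g (\<sigma>(i := s))\<bar> \<le> L" if "s = 1 \<or> s = -1" for s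
    unfolding comm using g k spin_configs_upd[OF \<sigma> i that] by (auto simp: flip_lipschitz_def)
  \<comment> \<open>The two outcomes of resampling site i are neighbours; this is the gap multiplied
    by the change of \<open>plus_prob\<close>.\<close>
  have "\<bar>g ((\<sigma>(i := -1))(i := 1)) - g (\<sigma>(i := -1))\<bar> \<le> L"
    by (rule flip_lipschitz_upd[OF g spin_configs_upd[OF \<sigma> i] i]) auto
  then show ?thesis
    unfolding heat_bath_def
    using plus_prob_nonneg plus_prob_le_1 nbr[of 1] nbr[of "-1"] plus_prob_flip[OF \<beta> \<sigma> k, of i] g(2)
    by (intro abs_mixture_diff_le) auto
qed

text \<open>Resampling site k erases the disagreement there; each of the other n - 1 sites
  contributes at most L + \<beta> L / n. Averaging gives at most ((n - 1) L + \<beta> L) / n, a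
  strict contraction of a positive L once \<beta> < 1.\<close>

lemma flip_lipschitz_glauber:
  assumes \<beta>: "0 \<le> \<beta>" and n: "n > 0" and g: "flip_lipschitz n L g"
  shows "flip_lipschitz n ((1 - (1 - \<beta>) / real n) * L) (glauber \<beta> n g)"
  unfolding flip_lipschitz_def
proof (intro ballI)
  fix \<sigma> k assume \<sigma>: "\<sigma> \<in> spin_configs n" and k: "k \<in> {1..n}"
  let ?d = "\<lambda>i. heat_bath \<beta> n i g (flip k \<sigma>) - heat_bath \<beta> n i g \<sigma>"
  have L: "0 \<le> L" by (rule flip_lipschitz_nonneg[OF g n])
  \<comment> \<open>\<open>heat_bath\<close> at k overwrites the spin at k, so it cannot see the
    flip.\<close>
  have "?d k = 0" by (simp add: flip_def)
  then have "(\<Sum>i\<in>{1..n}. ?d i) = (\<Sum>i\<in>{1..n} - {k}. ?d i)"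
    using sum.remove[OF finite_atLeastAtMost k, of ?d] by simp
  also have "\<bar>\<dots>\<bar> \<le> (\<Sum>i\<in>{1..n} - {k}. L + \<beta> / real n * L)"
    using heat_bath_flip_diff[OF \<beta> g L \<sigma> _ k] by (intro sum_abs[THEN order.trans] sum_mono) auto
  also have "\<dots> = (real n - 1) * (L + \<beta> / real n * L)"
    using k n by (simp add: card_Diff_singleton of_nat_diff)
  also have "\<dots> = (real n - 1) * L + (real n - 1) / real n * (\<beta> * L)" by (simp add: algebra_simps)
  also have "\<dots> \<le> (real n - 1) * L + 1 * (\<beta> * L)"
    using n \<beta> L by (intro add_left_mono mult_right_mono) auto
  finally have "\<bar>\<Sum>i\<in>{1..n}. ?d i\<bar> / real n \<le> ((real n - 1) * L + \<beta> * L) / real n"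
    using n by (intro divide_right_mono) auto
  also have "\<dots> = (1 - (1 - \<beta>) / real n) * L" using n by (simp add: field_simps)
  finally show "\<bar>glauber \<beta> n g (flip k \<sigma>) - glauber \<beta> n g \<sigma>\<bar> \<le> (1 - (1 - \<beta>) / real n) * L"
    using n by (simp add: glauber_def sum_subtractf flip: diff_divide_distrib)
qed

section \<open>Exponential moments under the kernel and the measure\<close>

text \<open>The comparison is required only one update away from \<sigma>, which is where Lipschitz
  estimates around \<sigma> apply.\<close>

lemma glauber_mono:
  assumes "\<And>i s. i \<in> {1..n} \<Longrightarrow> s = 1 \<or> s = -1 \<Longrightarrow> g (\<sigma>(i := s)) \<le> h (\<sigma>(i := s))"
  shows "glauber \<beta> n g \<sigma> \<le> glauber \<beta> n h \<sigma>"
  unfolding glauber_def heat_bath_def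
  by (intro divide_right_mono sum_mono add_mono mult_left_mono assms)
     (auto simp: plus_prob_nonneg plus_prob_le_1)

lemma glauber_affine:
  assumes "n > 0"
  shows "glauber \<beta> n (\<lambda>\<sigma>. a * g \<sigma> + c) \<sigma> = a * glauber \<beta> n g \<sigma> + c"
proof -
  have "heat_bath \<beta> n i (\<lambda>\<sigma>. a * g \<sigma> + c) \<sigma> = a * heat_bath \<beta> n i g \<sigma> + c" for i
    by (simp add: heat_bath_def algebra_simps)
  then show ?thesis
    using assms by (simp add: glauber_def sum.distrib add_divide_distrib flip: sum_distrib_left)
qed

text \<open>After one update \<open>g\<close> is within L of \<open>g \<sigma>\<close>, as is its
  one-step mean m, so y = g - m satisfies y^2 \<le> 4 L^2. Bounding exp y by y + exp (4 L^2) and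
  averaging removes the linear term.\<close>

lemma glauber_exp_le:
  assumes n: "n > 0" and g: "flip_lipschitz n L g" and \<sigma>: "\<sigma> \<in> spin_configs n"
  shows "glauber \<beta> n (\<lambda>\<tau>. exp (g \<tau>)) \<sigma> \<le> exp (4 * L\<^sup>2) * exp (glauber \<beta> n g \<sigma>)"
proof -
  define m where "m = glauber \<beta> n g \<sigma>"
  have L: "0 \<le> L" by (rule flip_lipschitz_nonneg[OF g n])
  have near: "\<bar>g (\<sigma>(i := s)) - g \<sigma>\<bar> \<le> L" if "i \<in> {1..n}" "s = 1 \<or> s = -1" for i s
    by (rule flip_lipschitz_upd[OF g L \<sigma> that])
  have const: "glauber \<beta> n (\<lambda>_. c) \<sigma> = c" for c
    using glauber_affine[OF n, of \<beta> 0 g c \<sigma>] by simp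
  have "glauber \<beta> n g \<sigma> \<le> glauber \<beta> n (\<lambda>_. g \<sigma> + L) \<sigma>"
    "glauber \<beta> n (\<lambda>_. g \<sigma> - L) \<sigma> \<le> glauber \<beta> n g \<sigma>"
    by (intro glauber_mono; use near in \<open>fastforce simp: abs_le_iff\<close>)+
  then have m: "\<bar>m - g \<sigma>\<bar> \<le> L" by (simp add: const m_def abs_le_iff)
  \<comment> \<open>The bound is affine in \<open>g\<close>, so \<open>glauber_affine\<close>
    evaluates its average exactly and the terms in m cancel.\<close>
  have step: "exp (g (\<sigma>(i := s))) \<le> exp m * g (\<sigma>(i := s)) + exp m * (exp (4 * L\<^sup>2) - m)"
    if "i \<in> {1..n}" "s = 1 \<or> s = -1" for i s
  proof -
    define y where "y = g (\<sigma>(i := s)) - m"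
    have "\<bar>y\<bar> \<le> 2 * L" using near[OF that] m unfolding y_def by linarith
    then have "y\<^sup>2 \<le> (2 * L)\<^sup>2" by (metis abs_ge_zero power2_abs power_mono)
    then have "exp y \<le> y + exp (4 * L\<^sup>2)"
      using exp_le_add_exp_square[of y] by (smt (verit) exp_le_cancel_iff four_x_squared)
    then have "exp m * exp y \<le> exp m * (y + exp (4 * L\<^sup>2))" by simp
    then show ?thesis by (simp add: y_def algebra_simps flip: exp_add)
  qed
  have "glauber \<beta> n (\<lambda>\<tau>. exp (g \<tau>)) \<sigma>
      \<le> glauber \<beta> n (\<lambda>\<tau>. exp m * g \<tau> + exp m * (exp (4 * L\<^sup>2) - m)) \<sigma>"
    by (intro glauber_mono step)
  also have "\<dots> = exp (4 * L\<^sup>2) * exp m"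
    unfolding glauber_affine[OF n] m_def[symmetric] by (simp add: algebra_simps)
  finally show ?thesis by (simp add: m_def)
qed

text \<open>Each step replaces \<open>g\<close> by its image under the kernel, with a smaller
  constant. The middle term is the full geometric budget for all steps at once; the last is the
  diameter bound left after k contractions.\<close>

lemma cw_exp_moment_iter:
  assumes \<beta>: "0 \<le> \<beta>" "\<beta> < 1" and n: "n > 0"
  shows "flip_lipschitz n L g \<Longrightarrow> cw_expectation \<beta> n (\<lambda>\<sigma>. exp (g \<sigma>)) \<le>
    exp (cw_expectation \<beta> n g + 4 * L\<^sup>2 * (real n / (1 - \<beta>)) + (1 - (1 - \<beta>) / real n) ^ k * (real n * L))"
proof (induction k arbitrary: g L)
  case 0
  have "exp (g \<sigma>) \<le> exp (cw_expectation \<beta> n g + real n * L)" if "\<sigma> \<in> spin_configs n" for \<sigma>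
    using flip_lipschitz_le_expectation[OF 0 n that] by simp
  then have "cw_expectation \<beta> n (\<lambda>\<sigma>. exp (g \<sigma>)) \<le> exp (cw_expectation \<beta> n g + real n * L)"
    by (metis (no_types, lifting) cw_expectation_mono cw_expectation_const)
  also have "\<dots> \<le> exp (cw_expectation \<beta> n g + 4 * L\<^sup>2 * (real n / (1 - \<beta>)) + real n * L)"
    using \<beta> by simp
  finally show ?case by simp
next
  case (Suc k)
  define \<rho> where "\<rho> = 1 - (1 - \<beta>) / real n"
  define A where "A = real n / (1 - \<beta>)"
  have "(1 - \<beta>) / real n \<le> 1" using \<beta> n by (simp add: field_simps)
  then have \<rho>: "0 \<le> \<rho>" "\<rho> \<le> 1" using \<beta> by (simp_all add: \<rho>_def)
  have A: "0 \<le> A" using \<beta> by (simp add: A_def)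
  \<comment> \<open>A is 1 / (1 - \<rho>), the sum of the geometric series. The squared constants
    shrink by \<rho>^2, and \<rho>^2 \<le> \<rho> lets the budget \<open>4 * L\<^sup>2 * A\<close>
    pay for one step and all later ones.\<close>
  have "1 + \<rho> * A = A" using \<beta> n by (simp add: \<rho>_def A_def field_simps)
  moreover have "\<rho>\<^sup>2 * A \<le> \<rho> * A"
    using \<rho> A by (intro mult_right_mono) (simp_all add: power2_eq_square mult_left_le)
  ultimately have "4 * L\<^sup>2 * (1 + \<rho>\<^sup>2 * A) \<le> 4 * L\<^sup>2 * A" by (intro mult_left_mono) auto
  then have sum: "4 * L\<^sup>2 + 4 * (\<rho> * L)\<^sup>2 * A \<le> 4 * L\<^sup>2 * A"
    by (simp add: power_mult_distrib algebra_simps)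
  \<comment> \<open>Invariance inserts one kernel step under the expectation for free.\<close>
  have "cw_expectation \<beta> n (\<lambda>\<sigma>. exp (g \<sigma>)) = cw_expectation \<beta> n (glauber \<beta> n (\<lambda>\<sigma>. exp (g \<sigma>)))"
    by (simp add: cw_expectation_glauber[OF n])
  also have "\<dots> \<le> cw_expectation \<beta> n (\<lambda>\<sigma>. exp (4 * L\<^sup>2) * exp (glauber \<beta> n g \<sigma>))"
    by (intro cw_expectation_mono glauber_exp_le n Suc.prems)
  also have "\<dots> = exp (4 * L\<^sup>2) * cw_expectation \<beta> n (\<lambda>\<sigma>. exp (glauber \<beta> n g \<sigma>))"
    by (rule cw_expectation_cmult)
  also have "\<dots> \<le> exp (4 * L\<^sup>2) *
      exp (cw_expectation \<beta> n g + 4 * (\<rho> * L)\<^sup>2 * A + \<rho> ^ k * (real n * (\<rho> * L)))"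
    using Suc.IH[OF flip_lipschitz_glauber[OF \<beta>(1) n Suc.prems]]
    unfolding cw_expectation_glauber[OF n] \<rho>_def[symmetric] A_def[symmetric] by simp
  also have "\<dots> \<le> exp (cw_expectation \<beta> n g + 4 * L\<^sup>2 * A + \<rho> ^ Suc k * (real n * L))"
    using sum unfolding exp_add[symmetric] by (simp add: algebra_simps)
  finally show ?case unfolding \<rho>_def A_def .
qed

text \<open>Let k tend to infinity: since \<rho> < 1, the diameter term vanishes.\<close>

lemma cw_exp_moment:
  assumes \<beta>: "0 \<le> \<beta>" "\<beta> < 1" and n: "n > 0" and g: "flip_lipschitz n L g"
  shows "cw_expectation \<beta> n (\<lambda>\<sigma>. exp (g \<sigma>)) \<le>
    exp (cw_expectation \<beta> n g + 4 * L\<^sup>2 * (real n / (1 - \<beta>)))"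
proof -
  define \<rho> where "\<rho> = 1 - (1 - \<beta>) / real n"
  have "(1 - \<beta>) / real n \<le> 1" "(1 - \<beta>) / real n > 0" using \<beta> n by (simp_all add: field_simps)
  then have "0 \<le> \<rho>" "\<rho> < 1" by (simp_all add: \<rho>_def)
  then have "(\<lambda>k. \<rho> ^ k) \<longlonglongrightarrow> 0" by (rule LIMSEQ_realpow_zero)
  then have "(\<lambda>k. exp (cw_expectation \<beta> n g + 4 * L\<^sup>2 * (real n / (1 - \<beta>)) + \<rho> ^ k * (real n * L)))
      \<longlonglongrightarrow> exp (cw_expectation \<beta> n g + 4 * L\<^sup>2 * (real n / (1 - \<beta>)) + 0 * (real n * L))"
    by (intro tendsto_exp tendsto_add tendsto_mult tendsto_const)
  then show ?thesis
    by (rule LIMSEQ_le_const[where a = "cw_expectation \<beta> n (\<lambda>\<sigma>. exp (g \<sigma>))", THEN order.trans])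
       (use cw_exp_moment_iter[OF \<beta> n g] in \<open>auto simp: \<rho>_def\<close>)
qed

section \<open>Tail bounds\<close>

text \<open>Chernoff's method with the l-Lipschitz function l g. At the optimal l the exponent is -
  u^2 / (16 A), which is where 16 / (1 - \<beta>) comes from.\<close>

lemma cw_upper_tail:
  assumes \<beta>: "0 \<le> \<beta>" "\<beta> < 1" and n: "n > 0" and g: "flip_lipschitz n 1 g" and u: "u > 0"
  shows "cw_prob \<beta> n {\<sigma> \<in> spin_configs n. g \<sigma> - cw_expectation \<beta> n g \<ge> u}
    \<le> exp (- (u\<^sup>2 / (16 / (1 - \<beta>) * real n)))"
proof -
  define A where "A = real n / (1 - \<beta>)"
  define l where "l = u / (8 * A)" \<comment> \<open>minimises \<open>4 l\<^sup>2 A - l u\<close>\<close>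
  define m where "m = cw_expectation \<beta> n g"
  have A: "A > 0" using \<beta> n by (simp add: A_def)
  have l: "l > 0" using A u by (simp add: l_def)
  let ?T = "{\<sigma> \<in> spin_configs n. g \<sigma> - m \<ge> u}"
  have "cw_prob \<beta> n ?T \<le> (\<Sum>\<sigma>\<in>spin_configs n \<inter> ?T. cw_mass \<beta> n \<sigma> * (exp (- l * (m + u)) * exp (l * g \<sigma>)))"
    unfolding cw_prob_def
  proof (rule sum_mono)
    fix \<sigma> assume "\<sigma> \<in> spin_configs n \<inter> ?T"
    \<comment> \<open>On the event the factor exp (l (g - m - u)) is at least 1, so it dominates the
      indicator.\<close>
    then have "0 \<le> l * (g \<sigma> - m - u)" using l by simp
    then have "1 \<le> exp (- l * (m + u)) * exp (l * g \<sigma>)"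
      unfolding exp_add[symmetric] by (simp add: algebra_simps)
    then show "cw_mass \<beta> n \<sigma> \<le> cw_mass \<beta> n \<sigma> * (exp (- l * (m + u)) * exp (l * g \<sigma>))"
      using mult_left_mono[OF _ cw_mass_nonneg] by fastforce
  qed
  also have "\<dots> \<le> cw_expectation \<beta> n (\<lambda>\<sigma>. exp (- l * (m + u)) * exp (l * g \<sigma>))"
    unfolding cw_expectation_def
    by (intro sum_mono2 finite_spin_configs) (auto simp: cw_mass_nonneg)
  also have "\<dots> = exp (- l * (m + u)) * cw_expectation \<beta> n (\<lambda>\<sigma>. exp (l * g \<sigma>))"
    by (rule cw_expectation_cmult)
  also have "\<dots> \<le> exp (- l * (m + u)) * exp (l * m + 4 * l\<^sup>2 * A)"
    using cw_exp_moment[OF \<beta> n flip_lipschitz_cmult[OF g, of l]]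
    by (simp add: cw_expectation_cmult m_def A_def)
  also have "\<dots> = exp (4 * l\<^sup>2 * A - l * u)"
    unfolding exp_add[symmetric] by (simp add: algebra_simps)
  also have "4 * l\<^sup>2 * A - l * u = - (u\<^sup>2 / (16 * A))"
    using A by (simp add: l_def power2_eq_square field_simps)
  finally show ?thesis by (simp add: m_def A_def)
qed

theorem mainTheorem5:
  fixes \<beta> :: real
  assumes "0 \<le> \<beta>" and "\<beta> < 1"
  shows "\<exists>c C :: real. c > 0 \<and> C > 0 \<and>
    (\<forall>n :: nat. \<forall>f :: (nat \<Rightarrow> real) \<Rightarrow> real. \<forall>u :: real.
       n > 0 \<longrightarrow> hamming_1_lipschitz n f \<longrightarrow> u > 0 \<longrightarrow>
       cw_prob \<beta> n {\<sigma> \<in> spin_configs n. \<bar>f \<sigma> - cw_expectation \<beta> n f\<bar> \<ge> u}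
         \<le> C * exp (- (u\<^sup>2 / (c * real n))))"
proof (rule exI[of _ "16 / (1 - \<beta>)"], rule exI[of _ 2], intro conjI allI impI)
  \<comment> \<open>The first witness is the constant of the one-sided bound; the second, 2, counts
    the two tails.\<close>
  show "16 / (1 - \<beta>) > 0" using assms by simp
  fix n :: nat and f :: "(nat \<Rightarrow> real) \<Rightarrow> real" and u :: real
  assume n: "n > 0" and "hamming_1_lipschitz n f" and u: "u > 0"
  then have f: "flip_lipschitz n 1 f" by (simp add: hamming_1_lipschitz_flip)
  \<comment> \<open>The lower tail of \<open>f\<close> is the upper tail of its negative.\<close>
  have f': "flip_lipschitz n 1 (\<lambda>\<sigma>. - f \<sigma>)" using flip_lipschitz_cmult[OF f, of "-1"] by simp
  have neg: "cw_expectation \<beta> n (\<lambda>\<sigma>. - f \<sigma>) = - cw_expectation \<beta> n f"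
    using cw_expectation_cmult[of \<beta> n "-1" f] by simp
  let ?m = "cw_expectation \<beta> n f"
  let ?U = "{\<sigma> \<in> spin_configs n. f \<sigma> - ?m \<ge> u}" and ?D = "{\<sigma> \<in> spin_configs n. - f \<sigma> - - ?m \<ge> u}"
  have "{\<sigma> \<in> spin_configs n. \<bar>f \<sigma> - ?m\<bar> \<ge> u} \<subseteq> ?U \<union> ?D" by auto
  then have "cw_prob \<beta> n {\<sigma> \<in> spin_configs n. \<bar>f \<sigma> - ?m\<bar> \<ge> u}
      \<le> (\<Sum>\<sigma>\<in>(spin_configs n \<inter> ?U) \<union> (spin_configs n \<inter> ?D). cw_mass \<beta> n \<sigma>)"
    unfolding cw_prob_def
    by (intro sum_mono2) (auto simp: cw_mass_nonneg finite_spin_configs)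
  \<comment> \<open>Union bound: the mass of the intersection, which \<open>sum.union_inter\<close>
    adds to that of the union, is nonnegative.\<close>
  also have "\<dots> \<le> cw_prob \<beta> n ?U + cw_prob \<beta> n ?D"
    unfolding cw_prob_def
    using sum.union_inter[of "spin_configs n \<inter> ?U" "spin_configs n \<inter> ?D" "cw_mass \<beta> n"]
      sum_nonneg[of "(spin_configs n \<inter> ?U) \<inter> (spin_configs n \<inter> ?D)" "cw_mass \<beta> n"]
    by (simp add: cw_mass_nonneg finite_spin_configs)
  also have "\<dots> \<le> 2 * exp (- (u\<^sup>2 / (16 / (1 - \<beta>) * real n)))"
    using cw_upper_tail[OF assms n f u] cw_upper_tail[OF assms n f' u] unfolding neg by linarith
  finally show "cw_prob \<beta> n {\<sigma> \<in> spin_configs n. \<bar>f \<sigma> - ?m\<bar> \<ge> u}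
      \<le> 2 * exp (- (u\<^sup>2 / (16 / (1 - \<beta>) * real n)))" .
qed simp

end
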